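(* Let $w:[n]\to[0,\infty)$ be the unknown weights of a universe of $n$ elements, with $W=\sum_{i=1}^n w(i)>0$, such that the weights are decreasing up to some (unknown) point $j\in[n]$ and then increasing up to $n$, i.e. $w(1)\ge w(2)\ge\dots\ge w(j)$ and $w(j)\le w(j+1)\le\dots\le w(n)$. Let $\epsilon\in(0,1)$. There exists an algorithm that uses in total $O\left(\frac{1}{\epsilon^3}\log n+\frac{1}{\epsilon^6}\right)$ non-adaptive conditional samples and returns an estimate $\hat W$ such that, with probability at least $2/3$, $$(1-2\epsilon)W\le \hat W\le (1+\epsilon)W .$$ The algorithm additionally requires $O(\log n)$ adaptive evaluation queries to find the index of the minimum-weight element.
   Context: $[n]=\{1,\dots,n\}$ and $W(S)=\sum_{i\in S}w(i)$ for $S\subseteq[n]$. The weights are accessed only through the following oracles. Evaluation query: the algorithm submits $i\in[n]$ and receives $w(i)$; adaptive means that each query may depend on previous answers. Conditional sample: the algorithm submits a set $S\subseteq[n]$ and receives a pair $(i,w(i))$ with $i\in S$, drawn either with probability $w(i)/W(S)$ (weighted conditional sample) or with probability $1/|S|$ (uniform conditional sample). The conditional samples are non-adaptive: the query sets do not depend on the answers to conditional sampling queries (they may depend on the index found by the evaluation queries). The probability is over the samples.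
   Formalization: The index found by the evaluation queries is claimed to have minimum weight only when equal neighbouring weights occur only at the minimum; otherwise it can fail (all weights 1 except one 0 needs about n queries). The estimate and all query bounds hold for all stated weights. *)

theory Defs
  imports "HOL-Probability.Probability_Mass_Function"
begin

definition total_weight :: "(nat \<Rightarrow> real) \<Rightarrow> nat set \<Rightarrow> real" where
  "total_weight w S = (\<Sum>i\<in>S. w i)"

definition decreasing_then_increasing :: "nat \<Rightarrow> (nat \<Rightarrow> real) \<Rightarrow> nat \<Rightarrow> bool" where
  "decreasing_then_increasing n w j \<longleftrightarrow>
     j \<in> {1..n} \<and> antimono_on {1..j} w \<and> mono_on {j..n} w"

text \<open>When equal neighbours occur above the minimum, evaluation queries alone cannot locate a
  minimum-weight element: a single small weight hidden among equal ones can be found only by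
  exhaustive search. Strict decrease up to \<open>j\<close> and strict increase after it imply the condition
  below, which moreover allows several elements of minimum weight.\<close>

definition ties_only_at_minimum :: "nat \<Rightarrow> (nat \<Rightarrow> real) \<Rightarrow> bool" where
  "ties_only_at_minimum n w \<longleftrightarrow>
     (\<forall>i\<in>{1..<n}. w i = w (Suc i) \<longrightarrow> w i = Min (w ` {1..n}))"

text \<open>A deterministic adaptive procedure making evaluation queries, as a decision tree:
  \<open>Ask i k\<close> submits \<open>i\<close>, receives \<open>w i\<close> and continues as \<open>k (w i)\<close>.\<close>

datatype eval_search = Found nat | Ask nat "real \<Rightarrow> eval_search"

primrec found_index :: "(nat \<Rightarrow> real) \<Rightarrow> eval_search \<Rightarrow> nat" where
  "found_index w (Found m) = m"
| "found_index w (Ask i k) = found_index w (k (w i))"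

primrec transcript :: "(nat \<Rightarrow> real) \<Rightarrow> eval_search \<Rightarrow> (nat \<times> real) list" where
  "transcript w (Found m) = []"
| "transcript w (Ask i k) = (i, w i) # transcript w (k (w i))"

datatype sample_query = Weighted "nat set" | Uniform "nat set"

primrec query_set :: "sample_query \<Rightarrow> nat set" where
  "query_set (Weighted S) = S"
| "query_set (Uniform S) = S"

text \<open>The ratio \<open>w i / W S\<close> is meaningless when \<open>W S = 0\<close>; in that case
  a weighted query is answered uniformly. The definitions are only meant for finite nonempty
  \<open>S\<close> and weights that are nonnegative on \<open>S\<close>.\<close>

primrec sampled_index :: "(nat \<Rightarrow> real) \<Rightarrow> sample_query \<Rightarrow> nat pmf" where
  "sampled_index w (Weighted S) =
     (if total_weight w S = 0 then pmf_of_set S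
      else embed_pmf (\<lambda>i. if i \<in> S then w i / total_weight w S else 0))"
| "sampled_index w (Uniform S) = pmf_of_set S"

lemma pmf_sampled_index_Weighted:
  assumes "finite S" "\<And>i. i \<in> S \<Longrightarrow> 0 \<le> w i" "total_weight w S \<noteq> 0"
  shows "pmf (sampled_index w (Weighted S)) i = (if i \<in> S then w i / total_weight w S else 0)"
proof -
  have nn: "0 \<le> total_weight w S"
    using assms(2) by (auto simp: total_weight_def intro: sum_nonneg)
  have "(\<integral>\<^sup>+ x. ennreal (if x \<in> S then w x / total_weight w S else 0) \<partial>count_space UNIV)
      = (\<integral>\<^sup>+ x. ennreal (w x / total_weight w S) * indicator S x \<partial>count_space UNIV)"
    by (intro nn_integral_cong) (auto simp: indicator_def)
  also have "\<dots> = (\<Sum>x\<in>S. ennreal (w x / total_weight w S))"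
    using assms(1) by (simp add: nn_integral_count_space_indicator[symmetric] nn_integral_count_space_finite)
  also have "\<dots> = ennreal (\<Sum>x\<in>S. w x / total_weight w S)"
    using assms nn by (intro sum_ennreal) auto
  also have "(\<Sum>x\<in>S. w x / total_weight w S) = 1"
    using assms(3) by (simp add: total_weight_def flip: sum_divide_distrib)
  finally show ?thesis
    using assms nn by (simp add: pmf_embed_pmf)
qed

text \<open>Independent answers to a list of queries that is fixed in advance.\<close>

primrec answers :: "(nat \<Rightarrow> real) \<Rightarrow> sample_query list \<Rightarrow> (nat \<times> real) list pmf" where
  "answers w [] = return_pmf []"
| "answers w (q # qs) =
     bind_pmf (sampled_index w q) (\<lambda>i.
       bind_pmf (answers w qs) (\<lambda>as. return_pmf ((i, w i) # as)))"

text \<open>The conditional sampling queries depend on the index found by the evaluation queries and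
  on nothing else; the estimate depends on the answers to both kinds of queries.\<close>

record sum_algorithm =
  search :: eval_search
  samples :: "nat \<Rightarrow> sample_query list"
  estimate :: "(nat \<times> real) list \<Rightarrow> (nat \<times> real) list \<Rightarrow> real"

definition estimate_pmf :: "sum_algorithm \<Rightarrow> (nat \<Rightarrow> real) \<Rightarrow> real pmf" where
  "estimate_pmf A w =
     map_pmf (estimate A (transcript w (search A)))
       (answers w (samples A (found_index w (search A))))"

end

theory Submission
  imports Defs
begin

text \<open>A uniform sample from a singleton is an evaluation query, so it suffices to give a linear
  estimator that reads few weights. Round every index \<open>i\<close> to a grid point \<open>r i\<close> whose distance
  from \<open>i\<close> is at most \<open>\<epsilon>\<close> times the distance to either end of the universe, and
  estimate the total weight by the sum of all \<open>w (r i)\<close>. For the indicator of an initial or a final segment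
  the relative error is at most \<open>\<epsilon>\<close>, and a decreasing-then-increasing function is a nonnegative
  combination of such indicators. Grids that are geometric from both ends have
  \<open>O(log n / \<epsilon> + 1)\<close> points. Where the minimum lies is irrelevant to the estimate, so it
  is not affected by ties that mislead the binary search.\<close>

section \<open>Locating the minimum\<close>

text \<open>The budget of halvings in the first argument makes the recursion primitive and bounds
  the queries at once. Each halving reads the slope between \<open>mid\<close> and
  \<open>Suc mid\<close>: an ascent or a tie keeps the left half, a descent the right half.\<close>

primrec binary_search :: "nat \<Rightarrow> nat \<Rightarrow> nat \<Rightarrow> eval_search" where
  "binary_search 0 lo hi = Found lo"
| "binary_search (Suc d) lo hi =
     (if hi \<le> lo then Found lo
      else let mid = (lo + hi) div 2 in
        Ask mid (\<lambda>x. Ask (Suc mid) (\<lambda>y.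
          if x \<le> y then binary_search d lo mid else binary_search d (Suc mid) hi)))"

lemma length_transcript_binary_search:
  "length (transcript w (binary_search d lo hi)) \<le> 2 * d"
  by (induction d arbitrary: lo hi) (auto simp: Let_def)

lemma found_index_binary_search_mem:
  "lo \<le> hi \<Longrightarrow> found_index w (binary_search d lo hi) \<in> {lo..hi}"
proof (induction d arbitrary: lo hi)
  case (Suc d)
  show ?case
  proof (cases "hi \<le> lo")
    case False
    then have "lo \<le> (lo + hi) div 2" "(lo + hi) div 2 < hi" by auto
    then show ?thesis
      using Suc.IH[of lo "(lo + hi) div 2"] Suc.IH[of "Suc ((lo + hi) div 2)" hi]
      by (simp add: Let_def)
  qed (use Suc.prems in auto)
qed auto

lemma set_transcript_binary_search:
  "fst ` set (transcript w (binary_search d lo hi)) \<subseteq> {lo..hi}"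
proof (induction d arbitrary: lo hi)
  case (Suc d)
  show ?case
  proof (cases "hi \<le> lo")
    case False
    define mid where "mid = (lo + hi) div 2"
    have mid: "lo \<le> mid" "mid < hi" using False by (auto simp: mid_def)
    have "fst ` set (transcript w (binary_search d lo mid)) \<subseteq> {lo..hi}"
      using mid by (intro order.trans[OF Suc.IH]) auto
    moreover have "fst ` set (transcript w (binary_search d (Suc mid) hi)) \<subseteq> {lo..hi}"
      using mid by (intro order.trans[OF Suc.IH]) auto
    ultimately show ?thesis
      using mid False by (simp add: Let_def flip: mid_def)
  qed auto
qed auto

text \<open>The invariant is that \<open>{lo..hi}\<close> contains a minimizer. A strict slope shows
  on which side of \<open>j\<close> the midpoint lies, hence which half keeps a minimizer; a tie
  occurs only at the minimum, so \<open>mid\<close> itself is one. When the budget runs out,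
  \<open>hi - lo < 1\<close> leaves only \<open>lo\<close>.\<close>

lemma found_index_binary_search_minimum:
  assumes valley: "decreasing_then_increasing n w j" and ties: "ties_only_at_minimum n w"
    and "1 \<le> lo" "hi \<le> n" "hi - lo < 2 ^ d"
    and "\<exists>i\<in>{lo..hi}. w i = Min (w ` {1..n})"
  shows "w (found_index w (binary_search d lo hi)) = Min (w ` {1..n})"
  using assms(3-)
proof (induction d arbitrary: lo hi)
  case 0
  then have "{lo..hi} \<subseteq> {lo}" by auto
  then show ?case using 0 by auto
next
  case (Suc d)
  show ?case
  proof (cases "hi \<le> lo")
    case True
    then have "{lo..hi} \<subseteq> {lo}" by auto
    then show ?thesis using Suc.prems True by auto
  next
    case False
    define mid where "mid = (lo + hi) div 2"
    have mid: "lo \<le> mid" "mid < hi" using False by (auto simp: mid_def)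
    obtain i where i: "i \<in> {lo..hi}" "w i = Min (w ` {1..n})" using Suc.prems by auto
    have least: "w i \<le> w k" if "k \<in> {1..n}" for k
      using i(2) that by simp
    have anti: "w b \<le> w a" if "1 \<le> a" "a \<le> b" "b \<le> j" for a b
      using valley that by (auto simp: decreasing_then_increasing_def monotone_on_def)
    have mono: "w a \<le> w b" if "j \<le> a" "a \<le> b" "b \<le> n" for a b
      using valley that by (auto simp: decreasing_then_increasing_def monotone_on_def)
    have *: "mid - lo < 2 ^ d" "hi - Suc mid < 2 ^ d"
      using Suc.prems(3) False by (auto simp: mid_def)
    show ?thesis
    proof (cases "w mid \<le> w (Suc mid)")
      case True
      have "\<exists>i\<in>{lo..mid}. w i = Min (w ` {1..n})"
      proof (cases "w mid = w (Suc mid)")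
        case True
        then have "w mid = Min (w ` {1..n})"
          using ties mid Suc.prems by (auto simp: ties_only_at_minimum_def)
        then show ?thesis using mid by auto
      next
        case False
        with True have less: "w mid < w (Suc mid)" by simp
        then have "j \<le> mid"
          using anti[of mid "Suc mid"] mid Suc.prems(1) by linarith
        have "w i \<le> w mid"
          using mid Suc.prems by (intro least) auto
        \<comment> \<open>A minimizer to the right of \<open>mid\<close> would weigh at least
          \<open>w (Suc mid)\<close>, since \<open>w\<close> increases from \<open>j\<close> on, and
          thus more than \<open>w mid\<close>.\<close>
        then have "i \<le> mid"
          using less \<open>j \<le> mid\<close> mono[of "Suc mid" i] i(1) Suc.prems(2)
          by (cases "i \<le> mid") auto
        then show ?thesis using i by auto
      qed
      then show ?thesis
        using Suc.IH[of lo mid] True False * mid Suc.prems by (simp add: Let_def flip: mid_def)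
    next
      case nle: False
      then have "mid < j"
        using mono[of mid "Suc mid"] mid Suc.prems(2) by linarith
      have "w i \<le> w (Suc mid)"
        using mid Suc.prems by (intro least) auto
      then have "Suc mid \<le> i"
        using nle \<open>mid < j\<close> anti[of i mid] i(1) Suc.prems(1)
        by (cases "i \<le> mid") auto
      then have "\<exists>i\<in>{Suc mid..hi}. w i = Min (w ` {1..n})"
        using i by auto
      then show ?thesis
        using Suc.IH[of "Suc mid" hi] nle False * mid Suc.prems
        by (simp add: Let_def flip: mid_def)
    qed
  qed
qed

section \<open>Sums over rounded indices\<close>

text \<open>Abel summation reduces the claim to the indicators of the initial segments \<open>{1..p}\<close>.\<close>

lemma rounded_sum_antimono:
  fixes f :: "nat \<Rightarrow> real"
  assumes range: "\<And>i. i \<in> {1..n} \<Longrightarrow> r i \<in> {1..n}"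
    and close: "\<And>i. i \<in> {1..n} \<Longrightarrow> \<bar>real (r i) - real i\<bar> \<le> \<epsilon> * min (real i) (real (r i))"
    and anti: "antimono_on {1..n} f" and nonneg: "\<And>i. i \<in> {1..n} \<Longrightarrow> 0 \<le> f i"
    and "0 \<le> \<epsilon>"
  shows "\<bar>(\<Sum>i=1..n. f (r i)) - (\<Sum>i=1..n. f i)\<bar> \<le> \<epsilon> * (\<Sum>i=1..n. f i)"
proof -
  \<comment> \<open>Extending \<open>f\<close> by zero makes the last drop \<open>d n\<close> equal
    to \<open>f n\<close>, so the telescoping sum leaves no remainder.\<close>
  define g where "g i = (if i \<le> n then f i else 0)" for i
  define d where "d p = g p - g (Suc p)" for p
  have d_nonneg: "0 \<le> d p" if "p \<in> {1..n}" for p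
    using that anti nonneg by (auto simp: d_def g_def monotone_on_def)
  have f_eq: "f i = (\<Sum>p=1..n. d p * of_bool (i \<le> p))" if "i \<in> {1..n}" for i
  proof -
    have "(\<Sum>p=1..n. d p * of_bool (i \<le> p)) = (\<Sum>p\<in>{i..n}. d p)"
      using that by (intro sum.mono_neutral_cong_right) auto
    also have "\<dots> = g i - g (Suc n)"
      using that sum_Suc_diff[of i n "\<lambda>p. - g p"] by (simp add: d_def)
    finally show ?thesis using that by (simp add: g_def)
  qed
  have swap: "(\<Sum>i=1..n. f (s i)) = (\<Sum>p=1..n. d p * real (card {i\<in>{1..n}. s i \<le> p}))"
    if "\<And>i. i \<in> {1..n} \<Longrightarrow> s i \<in> {1..n}" for s
  proof -
    have "(\<Sum>i=1..n. f (s i)) = (\<Sum>i=1..n. \<Sum>p=1..n. d p * of_bool (s i \<le> p))"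
      using that by (intro sum.cong refl f_eq) auto
    also have "\<dots> = (\<Sum>p=1..n. \<Sum>i=1..n. d p * of_bool (s i \<le> p))"
      by (rule sum.swap)
    also have "\<dots> = (\<Sum>p=1..n. d p * real (card {i\<in>{1..n}. s i \<le> p}))"
      by (intro sum.cong refl) (simp add: Int_def flip: sum_distrib_left)
    finally show ?thesis .
  qed
  \<comment> \<open>Only indices within \<open>\<epsilon> * real p\<close> of the border of
    \<open>{1..p}\<close> can cross it under rounding, in either direction.\<close>
  have segment: "\<bar>real (card {i\<in>{1..n}. r i \<le> p}) - real p\<bar> \<le> \<epsilon> * real p" if p: "p \<in> {1..n}" for p
  proof -
    define R where "R = {i\<in>{1..n}. r i \<le> p}"
    define e where "e = nat \<lfloor>\<epsilon> * real p\<rfloor>"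
    have e: "real e \<le> \<epsilon> * real p"
      using \<open>0 \<le> \<epsilon>\<close> by (simp add: e_def)
    have e_ge: "k \<le> e" if "real k \<le> \<epsilon> * real p" for k
      using that by (simp add: e_def le_nat_floor)
    have "R \<subseteq> {1..p + e}"
    proof
      fix i assume i: "i \<in> R"
      show "i \<in> {1..p + e}"
      proof (cases "i \<le> p")
        case False
        \<comment> \<open>Here \<open>r i \<le> p < i\<close>, so the displacement is at least
          \<open>i - p\<close>, and \<open>r i\<close> bounds the minimum in \<open>close\<close> by
          \<open>p\<close>.\<close>
        have "real (i - p) \<le> \<bar>real (r i) - real i\<bar>" using i False by (auto simp: R_def)
        also have "\<dots> \<le> \<epsilon> * min (real i) (real (r i))" using i close by (auto simp: R_def)
        also have "\<dots> \<le> \<epsilon> * real p"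
          using \<open>0 \<le> \<epsilon>\<close> i by (intro mult_left_mono) (auto simp: R_def)
        finally have "i - p \<le> e" by (rule e_ge)
        then show ?thesis using i by (auto simp: R_def)
      qed (use i in \<open>auto simp: R_def\<close>)
    qed
    from card_mono[OF _ this] have upper: "card R \<le> p + e" by simp
    have "{1..p} - R \<subseteq> {Suc p - e..p}"
    proof
      fix i assume i: "i \<in> {1..p} - R"
      \<comment> \<open>Now \<open>i \<le> p < r i\<close>: the displacement is at least
        \<open>Suc p - i\<close>, and it is \<open>i\<close> that bounds the minimum by
        \<open>p\<close>.\<close>
      have "real (Suc p - i) \<le> \<bar>real (r i) - real i\<bar>" using i p by (auto simp: R_def)
      also have "\<dots> \<le> \<epsilon> * min (real i) (real (r i))" using i p close by auto
      also have "\<dots> \<le> \<epsilon> * real p"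
        using \<open>0 \<le> \<epsilon>\<close> i by (intro mult_left_mono) auto
      finally have "Suc p - i \<le> e" by (rule e_ge)
      then show "i \<in> {Suc p - e..p}" using i by auto
    qed
    from card_mono[OF _ this] have "card ({1..p} - R) \<le> e" by simp
    moreover have "card {1..p} \<le> card R + card ({1..p} - R)"
      using card_mono[of "R \<union> ({1..p} - R)" "{1..p}"] card_Un_le[of R "{1..p} - R"]
      by (force simp: R_def)
    ultimately have "p \<le> card R + e" by simp
    then show ?thesis using upper e unfolding R_def[symmetric] by auto
  qed
  have initial: "card {i\<in>{1..n}. i \<le> p} = p" if "p \<in> {1..n}" for p
  proof -
    have "{i\<in>{1..n}. i \<le> p} = {1..p}" using that by auto
    then show ?thesis by simp
  qed
  have sum_f: "(\<Sum>i=1..n. f i) = (\<Sum>p=1..n. d p * real p)"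
    using swap[of "\<lambda>i. i"] initial by simp
  have sum_fr: "(\<Sum>i=1..n. f (r i)) = (\<Sum>p=1..n. d p * real (card {i\<in>{1..n}. r i \<le> p}))"
    using range by (rule swap)
  have "(\<Sum>i=1..n. f (r i)) - (\<Sum>i=1..n. f i)
      = (\<Sum>p=1..n. d p * (real (card {i\<in>{1..n}. r i \<le> p}) - real p))"
    unfolding sum_f sum_fr by (simp add: right_diff_distrib sum_subtractf)
  also have "\<bar>\<dots>\<bar> \<le> (\<Sum>p=1..n. d p * (\<epsilon> * real p))"
    using d_nonneg segment
    by (intro order.trans[OF sum_abs] sum_mono) (auto simp: abs_mult intro!: mult_left_mono)
  also have "\<dots> = \<epsilon> * (\<Sum>i=1..n. f i)"
    unfolding sum_f by (simp add: sum_distrib_left mult_ac)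
  finally show ?thesis .
qed

text \<open>Reflecting the universe by \<open>Suc n - i\<close> turns increasing into decreasing and
  exchanges the two ends; \<open>s\<close> is the rounding conjugated by this reflection.\<close>

lemma rounded_sum_mono:
  fixes f :: "nat \<Rightarrow> real"
  assumes range: "\<And>i. i \<in> {1..n} \<Longrightarrow> r i \<in> {1..n}"
    and close: "\<And>i. i \<in> {1..n} \<Longrightarrow>
      \<bar>real (r i) - real i\<bar> \<le> \<epsilon> * min (real (Suc n - i)) (real (Suc n - r i))"
    and mono: "mono_on {1..n} f" and nonneg: "\<And>i. i \<in> {1..n} \<Longrightarrow> 0 \<le> f i"
    and "0 \<le> \<epsilon>"
  shows "\<bar>(\<Sum>i=1..n. f (r i)) - (\<Sum>i=1..n. f i)\<bar> \<le> \<epsilon> * (\<Sum>i=1..n. f i)"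
proof -
  define s where "s i = Suc n - r (Suc n - i)" for i
  define g where "g i = f (Suc n - i)" for i
  have refl_mem: "Suc n - i \<in> {1..n}" if "i \<in> {1..n}" for i using that by auto
  have "\<bar>(\<Sum>i=1..n. g (s i)) - (\<Sum>i=1..n. g i)\<bar> \<le> \<epsilon> * (\<Sum>i=1..n. g i)"
  proof (rule rounded_sum_antimono)
    fix i assume i: "i \<in> {1..n}"
    note r = range[OF refl_mem[OF i]]
    show "s i \<in> {1..n}" using r by (auto simp: s_def)
    show "\<bar>real (s i) - real i\<bar> \<le> \<epsilon> * min (real i) (real (s i))"
      using close[OF refl_mem[OF i]] i r by (simp add: s_def of_nat_diff abs_minus_commute)
    show "0 \<le> g i" using nonneg refl_mem[OF i] by (simp add: g_def)
  next
    show "antimono_on {1..n} g"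
      unfolding g_def by (intro monotone_onI mono_onD[OF mono]) auto
  qed fact
  moreover have "(\<Sum>i=1..n. g i) = (\<Sum>i=1..n. f i)"
    unfolding g_def by (subst (2) sum.atLeastAtMost_rev) simp
  moreover have "(\<Sum>i=1..n. g (s i)) = (\<Sum>i=1..n. f (r (Suc n - i)))"
  proof (rule sum.cong[OF refl])
    fix i assume i: "i \<in> {1..n}"
    have "Suc n - (Suc n - r (Suc n - i)) = r (Suc n - i)"
      using range[OF refl_mem[OF i]] by auto
    then show "g (s i) = f (r (Suc n - i))"
      by (simp only: g_def s_def)
  qed
  moreover have "\<dots> = (\<Sum>i=1..n. f (r i))"
    by (subst (2) sum.atLeastAtMost_rev) simp
  ultimately show ?thesis by simp
qed

text \<open>Freezing \<open>w\<close> at \<open>w j\<close> after \<open>j\<close> gives a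
  decreasing part, and the rise above \<open>w j\<close> gives an increasing part. Both are
  nonnegative and add up to \<open>w\<close>, so the two one-sided errors add up to the claimed
  one.\<close>

lemma rounded_sum_valley:
  assumes range: "\<And>i. i \<in> {1..n} \<Longrightarrow> r i \<in> {1..n}"
    and left: "\<And>i. i \<in> {1..n} \<Longrightarrow> \<bar>real (r i) - real i\<bar> \<le> \<epsilon> * min (real i) (real (r i))"
    and right: "\<And>i. i \<in> {1..n} \<Longrightarrow>
      \<bar>real (r i) - real i\<bar> \<le> \<epsilon> * min (real (Suc n - i)) (real (Suc n - r i))"
    and valley: "decreasing_then_increasing n w j"
    and nonneg: "\<And>i. i \<in> {1..n} \<Longrightarrow> 0 \<le> w i" and "0 \<le> \<epsilon>"
  shows "\<bar>(\<Sum>i=1..n. w (r i)) - (\<Sum>i=1..n. w i)\<bar> \<le> \<epsilon> * (\<Sum>i=1..n. w i)"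
proof -
  define f where "f i = w (min i j)" for i
  define g where "g i = w (max i j) - w j" for i
  have w_eq: "w i = f i + g i" for i by (simp add: f_def g_def min_def max_def)
  have j: "j \<in> {1..n}" and anti: "antimono_on {1..j} w" and mono: "mono_on {j..n} w"
    using valley by (auto simp: decreasing_then_increasing_def)
  have "\<bar>(\<Sum>i=1..n. f (r i)) - (\<Sum>i=1..n. f i)\<bar> \<le> \<epsilon> * (\<Sum>i=1..n. f i)"
  proof (rule rounded_sum_antimono)
    show "antimono_on {1..n} f"
      unfolding f_def using anti j by (auto simp: monotone_on_def)
  qed (use range left nonneg j \<open>0 \<le> \<epsilon>\<close> in \<open>auto simp: f_def min_def\<close>)
  moreover have "\<bar>(\<Sum>i=1..n. g (r i)) - (\<Sum>i=1..n. g i)\<bar> \<le> \<epsilon> * (\<Sum>i=1..n. g i)"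
  proof (rule rounded_sum_mono)
    show "mono_on {1..n} g"
      unfolding g_def using mono j by (auto simp: monotone_on_def)
    show "0 \<le> g i" if "i \<in> {1..n}" for i
      using mono j that by (auto simp: g_def monotone_on_def)
  qed (use range right \<open>0 \<le> \<epsilon>\<close> in auto)
  ultimately show ?thesis
    unfolding w_eq sum.distrib distrib_left by linarith
qed

section \<open>The geometric grid\<close>

text \<open>For positive \<epsilon> and \<open>i\<close> this is the largest point not above
  \<open>i\<close> among the powers of \<open>1 + \<epsilon>\<close> rounded up to integers.\<close>

definition geometric_floor :: "real \<Rightarrow> nat \<Rightarrow> nat" where
  "geometric_floor \<epsilon> i = nat \<lceil>(1 + \<epsilon>) ^ nat \<lfloor>log (1 + \<epsilon>) (real i)\<rfloor>\<rceil>"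

text \<open>The index lies between two consecutive powers of \<open>1 + \<epsilon>\<close>. As
  \<open>i\<close> is an integer, taking the ceiling of the lower power does not exceed it.\<close>

lemma geometric_floor_bounds:
  assumes "0 < \<epsilon>" "1 \<le> i"
  shows "1 \<le> geometric_floor \<epsilon> i" "geometric_floor \<epsilon> i \<le> i"
    and "real i \<le> (1 + \<epsilon>) * real (geometric_floor \<epsilon> i)"
proof -
  define k where "k = nat \<lfloor>log (1 + \<epsilon>) (real i)\<rfloor>"
  have "0 \<le> log (1 + \<epsilon>) (real i)" using assms by simp
  then have k: "real k \<le> log (1 + \<epsilon>) (real i)" "log (1 + \<epsilon>) (real i) < real (Suc k)"
    unfolding k_def by linarith+
  have lower: "(1 + \<epsilon>) ^ k \<le> real i"
    using k(1) assms by (simp add: le_log_iff powr_realpow)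
  have upper: "real i < (1 + \<epsilon>) ^ Suc k"
    using k(2) assms by (simp add: log_less_iff powr_realpow del: of_nat_Suc power_Suc)
  have grid: "geometric_floor \<epsilon> i = nat \<lceil>(1 + \<epsilon>) ^ k\<rceil>"
    by (simp add: geometric_floor_def k_def)
  have "1 \<le> (1 + \<epsilon>) ^ k" using assms by simp
  then show "1 \<le> geometric_floor \<epsilon> i" unfolding grid by linarith
  show "geometric_floor \<epsilon> i \<le> i" unfolding grid using lower by linarith
  have "(1 + \<epsilon>) ^ k \<le> real (geometric_floor \<epsilon> i)" unfolding grid by linarith
  then have "(1 + \<epsilon>) ^ Suc k \<le> (1 + \<epsilon>) * real (geometric_floor \<epsilon> i)"
    using assms by simp
  then show "real i \<le> (1 + \<epsilon>) * real (geometric_floor \<epsilon> i)" using upper by linarith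
qed

text \<open>From \<open>ln y \<le> y - 1\<close> at \<open>y = 1 / (1 + x)\<close> one gets
  \<open>x / (1 + x)\<close> as a lower bound, and the denominator is at most 2. This serves to
  change the base of logarithms.\<close>

lemma half_le_ln_one_plus:
  assumes "0 \<le> x" "x \<le> 1"
  shows "x / 2 \<le> ln (1 + x :: real)"
proof -
  have "x / 2 \<le> 1 - 1 / (1 + x)" using assms mult_left_mono[of x 1 x] by (simp add: field_simps)
  also have "\<dots> \<le> ln (1 + x)"
    using ln_le_minus_one[of "1 / (1 + x)"] assms by (simp add: ln_div)
  finally show ?thesis .
qed

text \<open>There is at most one grid point per exponent from 0 to the floor of the logarithm of
  \<open>n\<close> to base \<open>1 + \<epsilon>\<close>.\<close>

lemma card_geometric_floor:
  assumes "0 < \<epsilon>" "\<epsilon> < 1" "1 \<le> n"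
  shows "real (card (geometric_floor \<epsilon> ` {1..n})) \<le> 1 + 2 * ln (real n) / \<epsilon>"
proof -
  define K where "K = nat \<lfloor>log (1 + \<epsilon>) (real n)\<rfloor>"
  have "geometric_floor \<epsilon> ` {1..n} \<subseteq> (\<lambda>k. nat \<lceil>(1 + \<epsilon>) ^ k\<rceil>) ` {..K}"
    using assms unfolding geometric_floor_def K_def
    by (auto intro!: image_eqI[OF refl] nat_mono floor_mono)
  then have "card (geometric_floor \<epsilon> ` {1..n}) \<le> card {..K}"
    by (rule surj_card_le[rotated]) simp
  then have "real (card (geometric_floor \<epsilon> ` {1..n})) \<le> 1 + real K" by simp
  also have "real K \<le> ln (real n) / ln (1 + \<epsilon>)"
    using assms by (simp add: K_def log_def)
  also have "\<dots> \<le> ln (real n) / (\<epsilon> / 2)"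
    using assms half_le_ln_one_plus[of \<epsilon>] by (intro divide_left_mono) auto
  finally show ?thesis by (simp add: mult_ac)
qed

text \<open>Every index is rounded towards its nearer end. Distances are counted from the positions
  0 and \<open>Suc n\<close>, so they are at least 1.\<close>

definition round_index :: "real \<Rightarrow> nat \<Rightarrow> nat \<Rightarrow> nat" where
  "round_index \<epsilon> n i =
     (if 2 * i \<le> Suc n then geometric_floor \<epsilon> i else Suc n - geometric_floor \<epsilon> (Suc n - i))"

lemma round_index_close:
  assumes "0 < \<epsilon>" "i \<in> {1..n}"
  shows "round_index \<epsilon> n i \<in> {1..n}"
    and "\<bar>real (round_index \<epsilon> n i) - real i\<bar>
           \<le> \<epsilon> * min (real i) (real (round_index \<epsilon> n i))"
    and "\<bar>real (round_index \<epsilon> n i) - real i\<bar>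
           \<le> \<epsilon> * min (real (Suc n - i)) (real (Suc n - round_index \<epsilon> n i))"
proof -
  let ?r = "round_index \<epsilon> n i"
  \<comment> \<open>The witness is the distance of \<open>?r\<close> from the end nearer to
    \<open>i\<close>: \<open>?r\<close> in the left half, \<open>Suc n - ?r\<close> in the right
    half. Rounding moves towards that end, so no other of the four distances is smaller.\<close>
  obtain a where a: "1 \<le> a" "a \<le> i" "a \<le> ?r" "a \<le> Suc n - i" "a \<le> Suc n - ?r"
    and close: "\<bar>real ?r - real i\<bar> \<le> \<epsilon> * real a"
  proof (cases "2 * i \<le> Suc n")
    case True
    then show ?thesis
      using that[of ?r] geometric_floor_bounds[of \<epsilon> i] assms
      by (auto simp: round_index_def algebra_simps)
  next
    case False
    define b where "b = geometric_floor \<epsilon> (Suc n - i)"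
    have b: "1 \<le> b" "b \<le> Suc n - i" "real (Suc n - i) \<le> (1 + \<epsilon>) * real b"
      using geometric_floor_bounds[of \<epsilon> "Suc n - i"] assms by (auto simp: b_def)
    have r: "?r = Suc n - b" using False by (simp add: round_index_def b_def)
    show ?thesis
    proof (rule that[of b])
      have "\<bar>real ?r - real i\<bar> = real (Suc n - i) - real b"
        using b(1,2) assms unfolding r by (simp add: of_nat_diff)
      then show "\<bar>real ?r - real i\<bar> \<le> \<epsilon> * real b"
        using b(3) by (simp add: algebra_simps)
    qed (use b(1,2) False assms in \<open>auto simp: r\<close>)
  qed
  show "?r \<in> {1..n}" using a by auto
  show "\<bar>real ?r - real i\<bar> \<le> \<epsilon> * min (real i) (real ?r)"
    using a assms by (intro order.trans[OF close] mult_left_mono) auto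
  show "\<bar>real ?r - real i\<bar> \<le> \<epsilon> * min (real (Suc n - i)) (real (Suc n - ?r))"
    using a assms by (intro order.trans[OF close] mult_left_mono) (auto simp del: of_nat_Suc)
qed

text \<open>The left half uses the grid and the right half its mirror image, which doubles the
  count.\<close>

lemma card_round_index:
  assumes "0 < \<epsilon>" "\<epsilon> < 1" "1 \<le> n"
  shows "real (card (round_index \<epsilon> n ` {1..n})) \<le> 2 + 4 * ln (real n) / \<epsilon>"
proof -
  let ?G = "geometric_floor \<epsilon> ` {1..n}"
  have "round_index \<epsilon> n ` {1..n} \<subseteq> ?G \<union> (\<lambda>a. Suc n - a) ` ?G"
  proof
    fix a assume "a \<in> round_index \<epsilon> n ` {1..n}"
    then obtain i where "i \<in> {1..n}" "a = round_index \<epsilon> n i" by auto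
    moreover from this have "Suc n - i \<in> {1..n}" by auto
    ultimately show "a \<in> ?G \<union> (\<lambda>a. Suc n - a) ` ?G"
      unfolding round_index_def by (cases "2 * i \<le> Suc n") (simp_all only: if_True if_False, blast+)
  qed
  then have "card (round_index \<epsilon> n ` {1..n}) \<le> card (?G \<union> (\<lambda>a. Suc n - a) ` ?G)"
    by (intro card_mono) auto
  also have "\<dots> \<le> card ?G + card ((\<lambda>a. Suc n - a) ` ?G)" by (rule card_Un_le)
  also have "\<dots> \<le> 2 * card ?G"
    using card_image_le[of ?G "\<lambda>a. Suc n - a"] by simp
  finally show ?thesis using card_geometric_floor[OF assms] by linarith
qed

section \<open>The algorithm\<close>

lemma answers_Uniform_singletons:
  "answers w (map (\<lambda>i. Uniform {i}) is) = return_pmf (map (\<lambda>i. (i, w i)) is)"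
  by (induction "is") (simp_all add: pmf_of_set_singleton bind_return_pmf)

text \<open>Each grid point is sampled once, so the sample count is the grid size. The answers form
  a lookup table containing every rounded index, so \<open>the\<close> never meets
  \<open>None\<close>.\<close>

definition grid_algorithm :: "nat \<Rightarrow> real \<Rightarrow> sum_algorithm" where
  "grid_algorithm n \<epsilon> =
     \<lparr>search = binary_search (nat \<lceil>log 2 (real n)\<rceil>) 1 n,
      samples = \<lambda>_. map (\<lambda>i. Uniform {i}) (sorted_list_of_set (round_index \<epsilon> n ` {1..n})),
      estimate = \<lambda>_ as. \<Sum>i=1..n. the (map_of as (round_index \<epsilon> n i))\<rparr>"

lemma estimate_pmf_grid_algorithm:
  "estimate_pmf (grid_algorithm n \<epsilon>) w = return_pmf (\<Sum>i=1..n. w (round_index \<epsilon> n i))"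
  by (simp add: estimate_pmf_def grid_algorithm_def answers_Uniform_singletons map_of_map_restrict)

theorem theorem7:
  "\<exists>(A :: nat \<Rightarrow> real \<Rightarrow> sum_algorithm) (C :: real).
     \<forall>(n :: nat) (\<epsilon> :: real) (w :: nat \<Rightarrow> real) (j :: nat).
       0 < \<epsilon> \<longrightarrow> \<epsilon> < 1 \<longrightarrow>
       (\<forall>i\<in>{1..n}. 0 \<le> w i) \<longrightarrow>
       0 < total_weight w {1..n} \<longrightarrow>
       decreasing_then_increasing n w j \<longrightarrow>
       (let m = found_index w (search (A n \<epsilon>));
            evals = transcript w (search (A n \<epsilon>));
            qs = samples (A n \<epsilon>) m;
            W = total_weight w {1..n}
        in m \<in> {1..n} \<and>
           (\<forall>(i, x)\<in>set evals. i \<in> {1..n}) \<and>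
           real (length evals) \<le> C * ln (real n) \<and>
           (ties_only_at_minimum n w \<longrightarrow> w m = Min (w ` {1..n})) \<and>
           (\<forall>q\<in>set qs. query_set q \<noteq> {} \<and> query_set q \<subseteq> {1..n}) \<and>
           real (length qs) \<le> C * (1 / \<epsilon> ^ 3 * ln (real n) + 1 / \<epsilon> ^ 6) \<and>
           measure_pmf.prob (estimate_pmf (A n \<epsilon>) w) {x. (1 - 2 * \<epsilon>) * W \<le> x \<and> x \<le> (1 + \<epsilon>) * W} \<ge> 2 / 3)"
proof -
  have main: "let m = found_index w (search (grid_algorithm n \<epsilon>));
            evals = transcript w (search (grid_algorithm n \<epsilon>));
            qs = samples (grid_algorithm n \<epsilon>) m;
            W = total_weight w {1..n}
        in m \<in> {1..n} \<and>
           (\<forall>(i, x)\<in>set evals. i \<in> {1..n}) \<and>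
           real (length evals) \<le> 8 * ln (real n) \<and>
           (ties_only_at_minimum n w \<longrightarrow> w m = Min (w ` {1..n})) \<and>
           (\<forall>q\<in>set qs. query_set q \<noteq> {} \<and> query_set q \<subseteq> {1..n}) \<and>
           real (length qs) \<le> 8 * (1 / \<epsilon> ^ 3 * ln (real n) + 1 / \<epsilon> ^ 6) \<and>
           measure_pmf.prob (estimate_pmf (grid_algorithm n \<epsilon>) w)
             {x. (1 - 2 * \<epsilon>) * W \<le> x \<and> x \<le> (1 + \<epsilon>) * W} \<ge> 2 / 3"
    if \<epsilon>: "0 < \<epsilon>" "\<epsilon> < 1" and nonneg: "\<forall>i\<in>{1..n}. 0 \<le> w i"
      and W: "0 < total_weight w {1..n}" and valley: "decreasing_then_increasing n w j"
    for n \<epsilon> w j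
  proof -
    define d where "d = nat \<lceil>log 2 (real n)\<rceil>"
    define s where "s = binary_search d 1 n"
    have n: "1 \<le> n" using valley by (auto simp: decreasing_then_increasing_def)
    \<comment> \<open>Each halving costs two queries. For \<open>n \<ge> 2\<close>, rounding up is
      absorbed by \<open>log 2 (real n) \<ge> 1\<close>, and \<open>ln 2 \<ge> 1 / 2\<close> gives
      the constant 8; for \<open>n = 1\<close> both sides vanish.\<close>
    have d_le: "real (2 * d) \<le> 8 * ln (real n)"
    proof (cases "n = 1")
      case False
      then have "ln 2 \<le> ln (real n)" using n by simp
      have "real d \<le> log 2 (real n) + 1" using n by (simp add: d_def)
      also have "\<dots> \<le> 2 * log 2 (real n)" using False n by simp
      also have "\<dots> = 2 * ln (real n) / ln 2" by (simp add: log_def)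
      also have "\<dots> \<le> 2 * ln (real n) / (1 / 2)"
        using half_le_ln_one_plus[of 1] n
        by (intro divide_left_mono) auto
      finally show ?thesis by simp
    qed (simp add: d_def)
    have "real n \<le> real (2 ^ d)"
    proof -
      have "log 2 (real n) \<le> real d" unfolding d_def by linarith
      then show ?thesis using n by (simp add: log_le_iff powr_realpow)
    qed
    then have width: "n - 1 < 2 ^ d" using n unfolding of_nat_le_iff by linarith
    have "Min (w ` {1..n}) \<in> w ` {1..n}" using n by (intro Min_in) auto
    then have min: "\<exists>i\<in>{1..n}. w i = Min (w ` {1..n})" by force
    \<comment> \<open>As \<epsilon> is below 1, \<open>1 / \<epsilon> ^ 6\<close> absorbs the
      additive constant and \<open>1 / \<epsilon> ^ 3\<close> dominates the factor
      \<open>1 / \<epsilon>\<close> of the logarithm.\<close>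
    have count: "real (card (round_index \<epsilon> n ` {1..n})) \<le> 8 * (1 / \<epsilon> ^ 3 * ln (real n) + 1 / \<epsilon> ^ 6)"
    proof -
      have "1 \<le> 1 / \<epsilon> ^ 6" using \<epsilon> by (simp add: power_le_one)
      moreover have "1 / \<epsilon> \<le> 1 / \<epsilon> ^ 3"
        using \<epsilon> power_decreasing[of 1 3 \<epsilon>] by (intro divide_left_mono) auto
      then have "1 / \<epsilon> * ln (real n) \<le> 1 / \<epsilon> ^ 3 * ln (real n)"
        using n by (intro mult_right_mono) auto
      moreover have "0 \<le> 1 / \<epsilon> * ln (real n)" using n \<epsilon> by simp
      moreover have "real (card (round_index \<epsilon> n ` {1..n})) \<le> 2 + 4 * (1 / \<epsilon> * ln (real n))"
        using card_round_index[OF \<epsilon> n] by simp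
      moreover have "2 + 4 * x \<le> 8 * (y + z)" if "1 \<le> z" "x \<le> y" "0 \<le> x" for x y z :: real
        unfolding distrib_left using that by linarith
      ultimately show ?thesis by (meson order.trans)
    qed
    have "\<bar>(\<Sum>i=1..n. w (round_index \<epsilon> n i)) - total_weight w {1..n}\<bar> \<le> \<epsilon> * total_weight w {1..n}"
      unfolding total_weight_def
      using round_index_close[OF \<epsilon>(1)] valley nonneg \<epsilon>
      by (intro rounded_sum_valley) auto
    \<comment> \<open>This sign relaxes the lower error from \<epsilon> to twice \<epsilon>.\<close>
    moreover have "0 \<le> \<epsilon> * total_weight w {1..n}" using \<epsilon> W by simp
    ultimately have "(\<Sum>i=1..n. w (round_index \<epsilon> n i))
        \<in> {x. (1 - 2 * \<epsilon>) * total_weight w {1..n} \<le> x \<and> x \<le> (1 + \<epsilon>) * total_weight w {1..n}}"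
      unfolding mem_Collect_eq left_diff_distrib distrib_right mult_1 mult.assoc by linarith
    \<comment> \<open>The estimate is a point mass inside the interval, so the success probability
      is 1.\<close>
    then have prob: "measure_pmf.prob (estimate_pmf (grid_algorithm n \<epsilon>) w)
        {x. (1 - 2 * \<epsilon>) * total_weight w {1..n} \<le> x \<and> x \<le> (1 + \<epsilon>) * total_weight w {1..n}} = 1"
      unfolding estimate_pmf_grid_algorithm measure_return_pmf by (rule indicator_simps)
    have search: "search (grid_algorithm n \<epsilon>) = s"
      by (simp add: grid_algorithm_def s_def d_def)
    have queries: "samples (grid_algorithm n \<epsilon>) m
        = map (\<lambda>i. Uniform {i}) (sorted_list_of_set (round_index \<epsilon> n ` {1..n}))" for m
      by (simp add: grid_algorithm_def)
    show ?thesis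
      unfolding Let_def search prob queries
    proof (intro conjI impI)
      show "found_index w s \<in> {1..n}"
        unfolding s_def using n by (rule found_index_binary_search_mem)
      show "\<forall>(i, x)\<in>set (transcript w s). i \<in> {1..n}"
        unfolding s_def using set_transcript_binary_search[of w d 1 n] by force
      show "real (length (transcript w s)) \<le> 8 * ln (real n)"
        unfolding s_def using length_transcript_binary_search[of w d 1 n] d_le by linarith
      show "w (found_index w s) = Min (w ` {1..n})" if "ties_only_at_minimum n w"
        unfolding s_def
        using that width min by (intro found_index_binary_search_minimum[OF valley]) auto
    qed (use count round_index_close(1)[OF \<epsilon>(1)] in auto)
  qed
  show ?thesis
    by (intro exI[of _ grid_algorithm] exI[of _ 8] allI impI) (rule main; assumption)
qed

end
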